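(* Let $N>p>1$, $s>-p$, $0<\mu<\bar\mu:=\big(\frac{N-p}{p}\big)^p$ and $p-1<q\le q_S$, where $q_S:=p-1+\frac{p+s}{\nu_+}$. Then, for every $R_0>0$, the equation $$-\big(r^{N-1}|v'|^{p-2}v'\big)'=\mu\,r^{N-1-p}v^{p-1}+r^{N-1+s}v^{q}$$ has no positive solution on $(R_0,+\infty)$.
   Context: $N,p,s,\mu,q$ are real parameters. A positive solution of the ODE on $(R_0,+\infty)$ means a positive function $v\in C^1((R_0,+\infty))$ such that $r\mapsto r^{N-1}|v'|^{p-2}v'$ is of class $C^1$ and the equation holds pointwise. $\nu_+$ is the larger of the two roots $\nu_-<\nu_+$ of $h(\nu)=\mu$, where $h(\gamma):=\gamma^{p-1}\big(N-p-(p-1)\gamma\big)$ for $\gamma>0$; they satisfy $0<\nu_-<\frac{N-p}{p}<\nu_+<\frac{N-p}{p-1}$. *)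

theory Defs
  imports "HOL-Analysis.Analysis"
begin

definition h :: "real \<Rightarrow> real \<Rightarrow> real \<Rightarrow> real" where
  "h N p \<gamma> = \<gamma> powr (p - 1) * (N - p - (p - 1) * \<gamma>)"

definition mu_bar :: "real \<Rightarrow> real \<Rightarrow> real" where
  "mu_bar N p = ((N - p) / p) powr p"

text \<open>
  For \<open>1 < p < N\<close> the function \<open>h N p\<close> increases strictly on \<open>(0, (N - p) / p]\<close>, attains there the
  value \<open>mu_bar N p\<close>, and decreases strictly afterwards. So for \<open>0 < \<mu> < mu_bar N p\<close> there are
  exactly two positive roots of \<open>h N p \<gamma> = \<mu>\<close>, and the greatest one is well defined.
\<close>

definition nu_plus :: "real \<Rightarrow> real \<Rightarrow> real \<Rightarrow> real" where
  "nu_plus N p \<mu> = (GREATEST \<gamma>. 0 < \<gamma> \<and> h N p \<gamma> = \<mu>)"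

definition q_S :: "real \<Rightarrow> real \<Rightarrow> real \<Rightarrow> real \<Rightarrow> real" where
  "q_S N p s \<mu> = p - 1 + (p + s) / nu_plus N p \<mu>"

text \<open>
  Since \<open>0 powr a = 0\<close> and the factor \<open>deriv v r\<close> is present, the flux is \<open>0\<close> wherever
  \<open>deriv v r = 0\<close>, also for \<open>p \<le> 2\<close>; this is the usual convention for \<open>|t|\<^sup>p\<^sup>-\<^sup>2 t\<close> at \<open>t = 0\<close>.
\<close>

definition flux :: "real \<Rightarrow> real \<Rightarrow> (real \<Rightarrow> real) \<Rightarrow> real \<Rightarrow> real" where
  "flux N p v r = r powr (N - 1) * \<bar>deriv v r\<bar> powr (p - 2) * deriv v r"

text \<open>
  Solutions are total functions on the reals; since \<open>{R0<..}\<close> is open, only their values on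
  that interval matter.
\<close>

definition positive_solution ::
  "real \<Rightarrow> real \<Rightarrow> real \<Rightarrow> real \<Rightarrow> real \<Rightarrow> real \<Rightarrow> (real \<Rightarrow> real) \<Rightarrow> bool" where
  "positive_solution N p s \<mu> q R0 v \<longleftrightarrow>
     (\<forall>r>R0. 0 < v r) \<and>
     v C1_differentiable_on {R0<..} \<and>
     flux N p v C1_differentiable_on {R0<..} \<and>
     (\<forall>r>R0. - deriv (flux N p v) r =
        \<mu> * r powr (N - 1 - p) * v r powr (p - 1) + r powr (N - 1 + s) * v r powr q)"

end

theory Submission
  imports Defs
begin

text \<open>
  With \<open>t = ln r\<close>, \<open>z = - r v' / v\<close> and \<open>V = r\<^sup>p\<^sup>+\<^sup>s v\<^sup>q\<^sup>-\<^sup>p\<^sup>+\<^sup>1\<close> the equation becomes the autonomous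
  system \<open>(z\<^sup>p\<^sup>-\<^sup>1)' = \<mu> + V - h(z)\<close>, \<open>V' = V (p + s - (q - p + 1) z)\<close>. A global forward orbit
  has bounded \<open>z\<close>. Since \<open>h < \<mu>\<close> beyond \<open>\<nu>\<^sub>+\<close>, an orbit with \<open>z > \<nu>\<^sub>+\<close> at some time would
  be unbounded, so \<open>z \<le> \<nu>\<^sub>+\<close>; then \<open>q \<le> q\<^sub>S\<close> makes \<open>V\<close> nondecreasing. The positive lower
  bound on \<open>V\<close> improves the bound to \<open>z < \<kappa>\<close> for some \<open>\<kappa> < \<nu>\<^sub>+\<close>, so \<open>V\<close> grows exponentially,
  which again makes \<open>z\<close> unbounded.
\<close>

section \<open>Growth forced by differential inequalities on a half-line\<close>

text \<open>The bound on \<open>f'\<close> is available only where \<open>f\<close> is at least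
  \<open>f a\<close>. If \<open>f b < f a\<close>, then at the last point before \<open>b\<close>
  with value at least \<open>f a\<close> the derivative is positive, so a later such point exists.
  Hence \<open>f\<close> never falls below \<open>f a\<close> and the bound holds
  throughout.\<close>

lemma linear_growth:
  fixes f f' :: "real \<Rightarrow> real"
  assumes df: "\<And>t. a \<le> t \<Longrightarrow> (f has_real_derivative f' t) (at t)"
    and c: "\<And>t. a \<le> t \<Longrightarrow> f a \<le> f t \<Longrightarrow> c \<le> f' t" and "0 < c" and "a \<le> t"
  shows "f a + c * (t - a) \<le> f t"
proof -
  have cont: "continuous_on {a..b} f" for b
    using df by (intro continuous_at_imp_continuous_on) (meson DERIV_isCont atLeastAtMost_iff)
  have above: "f a \<le> f b" if "a \<le> b" for b
  proof (rule ccontr)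
    assume "\<not> f a \<le> f b"
    define S where "S = {x \<in> {a..b}. f a \<le> f x}"
    have "closed S"
      unfolding S_def
      by (intro continuous_on_closed_Collect_le continuous_on_const cont closed_atLeastAtMost)
    moreover have "S \<noteq> {}" "bounded S"
      using \<open>a \<le> b\<close> by (auto simp: S_def intro: bounded_subset[OF bounded_closed_interval[of a b]])
    ultimately obtain m where m: "m \<in> S" "\<And>x. x \<in> S \<Longrightarrow> x \<le> m"
      using compact_attains_sup[of S] compact_eq_bounded_closed by blast
    have "m < b" using m(1) \<open>\<not> f a \<le> f b\<close> by (cases "m = b") (auto simp: S_def)
    have "0 < f' m" using m(1) c[of m] \<open>0 < c\<close> by (auto simp: S_def)
    then obtain d where d: "0 < d" "\<And>h. 0 < h \<Longrightarrow> h < d \<Longrightarrow> f m < f (m + h)"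
      using DERIV_pos_inc_right[OF df] m(1) by (metis S_def atLeastAtMost_iff mem_Collect_eq)
    define e where "e = min (d / 2) (b - m)"
    have e: "0 < e" "e < d" "m + e \<le> b" using d(1) \<open>m < b\<close> by (auto simp: e_def)
    have "m + e \<in> S" using d(2)[OF e(1,2)] m(1) e by (auto simp: S_def)
    with m(2) e(1) show False by fastforce
  qed
  have "f a - c * a \<le> f t - c * t"
  proof (rule DERIV_nonneg_imp_nondecreasing[OF \<open>a \<le> t\<close>])
    fix x assume "a \<le> x" "x \<le> t"
    then show "\<exists>y. ((\<lambda>x. f x - c * x) has_real_derivative y) (at x) \<and> 0 \<le> y"
      using c[OF _ above] by (intro exI[of _ "f' x - c"]) (auto intro!: derivative_eq_intros df)
  qed
  then show ?thesis by (simp add: algebra_simps)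
qed

lemma linear_growth_unbounded:
  fixes f f' :: "real \<Rightarrow> real"
  assumes "\<And>t. a \<le> t \<Longrightarrow> (f has_real_derivative f' t) (at t)"
    and "\<And>t. a \<le> t \<Longrightarrow> f a \<le> f t \<Longrightarrow> c \<le> f' t" and "0 < c"
  obtains t where "a \<le> t" "B < f t"
proof -
  \<comment> \<open>At this time the linear lower bound exceeds \<open>B\<close>.\<close>
  define t where "t = a + (\<bar>B - f a\<bar> + 1) / c"
  have "a \<le> t" using \<open>0 < c\<close> by (simp add: t_def)
  moreover have "c * (t - a) = \<bar>B - f a\<bar> + 1" using \<open>0 < c\<close> by (simp add: t_def)
  ultimately show ?thesis
    using linear_growth[of a f f' c t] assms by (intro that[of t]) auto
qed

text \<open>Integrating factor: \<open>f t * exp (- k * t)\<close> is nondecreasing.\<close>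

lemma exponential_growth:
  fixes f f' :: "real \<Rightarrow> real"
  assumes df: "\<And>t. a \<le> t \<Longrightarrow> (f has_real_derivative f' t) (at t)"
    and k: "\<And>t. a \<le> t \<Longrightarrow> k * f t \<le> f' t" and "a \<le> t"
  shows "f a * exp (k * (t - a)) \<le> f t"
proof -
  have "f a * exp (- k * a) \<le> f t * exp (- k * t)"
  proof (rule DERIV_nonneg_imp_nondecreasing[OF \<open>a \<le> t\<close>])
    fix x assume "a \<le> x" "x \<le> t"
    then show "\<exists>y. ((\<lambda>x. f x * exp (- k * x)) has_real_derivative y) (at x) \<and> 0 \<le> y"
      using k[of x]
      by (intro exI[of _ "(f' x - k * f x) * exp (- k * x)"])
        (auto intro!: derivative_eq_intros df simp: algebra_simps)
  qed
  then have "f a * exp (- k * a) * exp (k * t) \<le> f t * exp (- k * t) * exp (k * t)"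
    by (intro mult_right_mono) auto
  then show ?thesis by (simp add: mult.assoc flip: exp_add) (simp add: algebra_simps)
qed

lemma exponential_growth_unbounded:
  fixes f f' :: "real \<Rightarrow> real"
  assumes "\<And>t. a \<le> t \<Longrightarrow> (f has_real_derivative f' t) (at t)"
    and "\<And>t. a \<le> t \<Longrightarrow> k * f t \<le> f' t" and "0 < k" "0 < f a"
  obtains b where "a \<le> b" "\<And>t. b \<le> t \<Longrightarrow> B \<le> f t"
proof -
  \<comment> \<open>Solves \<open>f a * k * (b - a) = |B|\<close>; the inequality
    \<open>exp x \<ge> x\<close> then suffices.\<close>
  define b where "b = a + \<bar>B\<bar> / (f a * k)"
  have ab: "a \<le> b" using assms by (simp add: b_def)
  have "B \<le> f t" if "b \<le> t" for t
  proof -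
    have "\<bar>B\<bar> = f a * (k * (b - a))" using assms by (simp add: b_def)
    also have "\<dots> \<le> f a * (k * (t - a))"
      using that assms by (intro mult_left_mono) auto
    also have "\<dots> \<le> f a * exp (k * (t - a))"
      using \<open>0 < f a\<close> exp_ge_add_one_self[of "k * (t - a)"] by (intro mult_left_mono) linarith+
    also have "\<dots> \<le> f t"
      using ab that assms by (intro exponential_growth[of a f f' k]) auto
    finally show ?thesis by simp
  qed
  with ab show ?thesis by (rule that)
qed

section \<open>Monotonicity of \<open>h\<close> and its larger root\<close>

lemma h_has_derivative:
  assumes "0 < x"
  shows "(h N p has_real_derivative (p - 1) * x powr (p - 2) * (N - p - p * x)) (at x)"
proof -
  have "x powr (p - 1) = x powr (p - 2) * x"
    using assms powr_add[of x "p - 2" 1] by simp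
  then show ?thesis
    unfolding h_def[abs_def] using assms
    by (auto intro!: derivative_eq_intros simp: algebra_simps)
qed

text \<open>Beyond \<open>(N - p) / p\<close> the factor \<open>N - p - p * x\<close> of the
  derivative is negative. The sign is checked on an open interval, so \<open>x\<close> may be the
  maximum point itself.\<close>

lemma h_strict_antimono:
  assumes "1 < p" "p < N" "(N - p) / p \<le> x" "x < y"
  shows "h N p y < h N p x"
proof -
  have "0 < x" using assms by (smt (verit) divide_pos_pos)
  have isC: "isCont (h N p) c" if "0 < c" for c
    using h_has_derivative[OF that] by (rule DERIV_isCont)
  show ?thesis
  proof (rule DERIV_neg_imp_decreasing_open[OF \<open>x < y\<close>])
    fix c assume c: "x < c" "c < y"
    then have "(N - p) / p < c" "0 < c" using assms \<open>0 < x\<close> by linarith+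
    then have "(p - 1) * c powr (p - 2) * (N - p - p * c) < 0"
      using assms by (intro mult_pos_neg mult_pos_pos) (auto simp: field_simps)
    then show "\<exists>d. (h N p has_real_derivative d) (at c) \<and> d < 0"
      using h_has_derivative[of c] c \<open>0 < x\<close> by (meson less_trans)
  qed (use isC \<open>0 < x\<close> in \<open>auto intro!: continuous_at_imp_continuous_on\<close>)
qed

text \<open>The intermediate value theorem between the maximum point and the zero
  \<open>(N - p) / (p - 1)\<close> of \<open>h\<close> gives a root; strict decrease rules out any
  larger one, so \<open>GREATEST\<close> picks it.\<close>

lemma nu_plus_properties:
  assumes "1 < p" "p < N" "0 < \<mu>" "\<mu> < mu_bar N p"
  shows "(N - p) / p < nu_plus N p \<mu>" "h N p (nu_plus N p \<mu>) = \<mu>"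
proof -
  let ?m = "(N - p) / p" and ?z = "(N - p) / (p - 1)"
  have m: "0 < ?m" "?m \<le> ?z" using assms by (auto simp: field_simps)
  have "N - p - (p - 1) * ?m = ?m" using assms by (simp add: field_simps)
  then have hm: "h N p ?m = mu_bar N p"
    using m assms powr_add[of ?m "p - 1" 1] by (simp only: h_def mu_bar_def) simp
  have hz: "h N p ?z = 0" using assms by (simp add: h_def)
  obtain x where x: "?m \<le> x" "h N p x = \<mu>"
    using IVT2[of "h N p" ?z \<mu> ?m] hm hz m assms h_has_derivative DERIV_isCont
    by (metis less_eq_real_def order_less_le_trans)
  have "nu_plus N p \<mu> = x"
    unfolding nu_plus_def
  proof (rule Greatest_equality)
    show "0 < x \<and> h N p x = \<mu>" using x m by linarith
    show "y \<le> x" if "0 < y \<and> h N p y = \<mu>" for y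
      using that x h_strict_antimono[of p N x y] assms by (cases "x < y") auto
  qed
  moreover have "x \<noteq> ?m" using hm x assms by auto
  ultimately show "?m < nu_plus N p \<mu>" "h N p (nu_plus N p \<mu>) = \<mu>" using x by auto
qed

section \<open>Nonexistence of global forward orbits\<close>

text \<open>Applied with \<open>\<sigma> = p + s\<close> and \<open>\<delta> = q - p + 1\<close>,
  where the second condition on \<open>\<delta>\<close> encodes \<open>q \<le> q_S\<close>. The
  upper bound on \<open>z\<close> is sharpened from \<open>Z\<close> to the root and then strictly
  below it.\<close>

lemma no_global_orbit:
  fixes N p \<mu> \<sigma> \<delta> :: real and z V :: "real \<Rightarrow> real"
  assumes p: "1 < p" "p < N" and \<mu>: "0 < \<mu>" "\<mu> < mu_bar N p"
    and \<delta>: "0 < \<delta>" "\<delta> * nu_plus N p \<mu> \<le> \<sigma>"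
    and z: "\<And>t. T \<le> t \<Longrightarrow> 0 < z t" and V: "\<And>t. T \<le> t \<Longrightarrow> 0 < V t"
    and dz: "\<And>t. T \<le> t \<Longrightarrow>
      ((\<lambda>t. z t powr (p - 1)) has_real_derivative \<mu> + V t - h N p (z t)) (at t)"
    and dV: "\<And>t. T \<le> t \<Longrightarrow> (V has_real_derivative V t * (\<sigma> - \<delta> * z t)) (at t)"
  shows False
proof -
  define Z where "Z = (N - p) / (p - 1)"
  define Y where "Y = (\<lambda>t. z t powr (p - 1))"
  let ?\<nu> = "nu_plus N p \<mu>"
  note nu = nu_plus_properties[OF p \<mu>]
  have Zpos: "0 < Z" using p by (simp add: Z_def)
  have Y_le_iff: "Y a \<le> Y b \<longleftrightarrow> z a \<le> z b" if "T \<le> a" "T \<le> b" for a b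
    using that z[of a] z[of b] p unfolding Y_def
    by (smt (verit) powr_less_mono2 powr_mono2)
  have z_le: "z t \<le> Z" if t: "T \<le> t" for t
  proof (rule ccontr)
    assume "\<not> z t \<le> Z"
    \<comment> \<open>\<open>u = 1 / z\<close> satisfies \<open>u' \<le> Z u - 1\<close>, so once \<open>u < 1 / Z\<close> it reaches \<open>0\<close> in finite time.\<close>
    define D where "D = (\<lambda>t. 1 / Z - Y t powr (- 1 / (p - 1)))"
    \<comment> \<open>This is \<open>u\<close>, written through \<open>Y\<close> because the
      hypotheses differentiate \<open>Y\<close> rather than \<open>z\<close>.\<close>
    have u: "Y t powr (- 1 / (p - 1)) = 1 / z t" if "T \<le> t" for t
      using z[OF that] p by (simp add: Y_def powr_powr powr_minus_divide)
    define D' where "D' = (\<lambda>t. Y t powr (- 1 / (p - 1) - 1) * (\<mu> + V t - h N p (z t)) / (p - 1))"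
    have dD: "(D has_real_derivative D' x) (at x)" if "t \<le> x" for x
    proof -
      have "T \<le> x" using that t by simp
      then have "0 < Y x" using z[of x] by (simp add: Y_def)
      then show ?thesis unfolding D_def D'_def
        using p dz[OF \<open>T \<le> x\<close>, folded Y_def]
        by (auto intro!: derivative_eq_intros simp: field_simps)
    qed
    moreover have "Z * D x \<le> D' x" if "t \<le> x" for x
    proof -
      have x: "T \<le> x" using that t by simp
      have zx: "0 < z x" and "0 < V x" using z V x by auto
      have "Y x powr (- 1 / (p - 1) - 1) = 1 / (z x * z x powr (p - 1))"
        using u[OF x] zx by (simp add: powr_diff Y_def)
      then have "D' x = (\<mu> + V x - h N p (z x)) / (z x * z x powr (p - 1) * (p - 1))"
        by (simp add: D'_def)
      \<comment> \<open>Dropping the positive \<open>\<mu> + V x\<close> leaves an expression in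
        \<open>z\<close> alone, which simplifies to \<open>Z * D x\<close>.\<close>
      also have "\<dots> \<ge> (- h N p (z x)) / (z x * z x powr (p - 1) * (p - 1))"
        using zx \<open>0 < V x\<close> \<mu> p by (intro divide_right_mono) auto
      also have "(- h N p (z x)) / (z x * z x powr (p - 1) * (p - 1)) = 1 - Z / z x"
        using zx p by (simp add: h_def Z_def field_simps)
      also have "\<dots> = Z * D x" using u[OF x] Zpos by (simp add: D_def field_simps)
      finally show ?thesis .
    qed
    moreover have "0 < D t"
      using u[OF t] \<open>\<not> z t \<le> Z\<close> Zpos by (simp add: D_def frac_less2)
    \<comment> \<open>Since \<open>1 / z\<close> is positive, \<open>D\<close> stays below
      \<open>1 / Z\<close>, so this level is unreachable.\<close>
    ultimately obtain b where b: "t \<le> b" "1 / Z + 1 \<le> D b"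
      using Zpos exponential_growth_unbounded[of t D D' Z "1 / Z + 1"] by (metis order_refl)
    then show False using u[of b] t z[of b] by (simp add: D_def field_simps)
  qed
  \<comment> \<open>Common source of the later contradictions: \<open>Y\<close> would grow linearly
    past \<open>Z powr (p - 1)\<close>, against \<open>z_le\<close>.\<close>
  have no_growth: False if a: "T \<le> a" "0 < c"
    and c: "\<And>t. a \<le> t \<Longrightarrow> z a \<le> z t \<Longrightarrow> c \<le> \<mu> + V t - h N p (z t)" for a c
  proof -
    obtain t where t: "a \<le> t" "Z powr (p - 1) < Y t"
      using linear_growth_unbounded[of a Y "\<lambda>t. \<mu> + V t - h N p (z t)" c "Z powr (p - 1)"]
        dz[folded Y_def] a c Y_le_iff by (metis order_trans)
    then show False
      using z_le[of t] z[of t] a p by (auto simp: Y_def not_le[symmetric] intro: powr_mono2)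
  qed
  have h_le: "h N p y \<le> h N p x" if "(N - p) / p \<le> x" "x \<le> y" for x y
    using h_strict_antimono[OF p, of x y] that by (cases "x = y") auto
  have z_le_nu: "z t \<le> ?\<nu>" if t: "T \<le> t" for t
  proof (rule ccontr)
    assume "\<not> z t \<le> ?\<nu>"
    then have "h N p (z t) < \<mu>" using h_strict_antimono[OF p, of ?\<nu> "z t"] nu by simp
    then show False
    proof (intro no_growth[of t "\<mu> - h N p (z t)"] t)
      fix x assume "t \<le> x" "z t \<le> z x"
      \<comment> \<open>Since \<open>h\<close> decreases here, the gap
        \<open>\<mu> - h N p (z t)\<close> persists wherever \<open>z\<close> is at least
        \<open>z t\<close>.\<close>
      moreover have "h N p (z x) \<le> h N p (z t)"
        using \<open>z t \<le> z x\<close> \<open>\<not> z t \<le> ?\<nu>\<close> nu by (intro h_le) auto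
      ultimately show "\<mu> - h N p (z t) \<le> \<mu> + V x - h N p (z x)" using V[of x] t by simp
    qed simp
  qed
  have V_ge: "V T \<le> V t" if "T \<le> t" for t
  proof (rule DERIV_nonneg_imp_nondecreasing[OF that])
    fix x assume x: "T \<le> x" "x \<le> t"
    have "\<delta> * z x \<le> \<delta> * ?\<nu>" using z_le_nu[OF x(1)] \<delta> by simp
    then show "\<exists>y. (V has_real_derivative y) (at x) \<and> 0 \<le> y"
      using dV[OF x(1)] V[OF x(1)] \<delta>(2) by (intro exI conjI) auto
  qed
  \<comment> \<open>By left continuity at the root, \<open>h\<close> exceeds \<open>\<mu>\<close> by
    at most half of \<open>V T\<close>; the other half remains as a growth rate for
    \<open>Y\<close>.\<close>
  obtain \<kappa> where \<kappa>: "(N - p) / p \<le> \<kappa>" "\<kappa> < ?\<nu>" "h N p \<kappa> \<le> \<mu> + V T / 2"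
  proof -
    have nupos: "0 < ?\<nu>" using nu p by (smt (verit) divide_pos_pos)
    have "(h N p \<longlongrightarrow> \<mu>) (at_left ?\<nu>)"
      using DERIV_isCont[OF h_has_derivative[OF nupos]] nu
      by (metis isCont_def filterlim_at_split)
    then have "eventually (\<lambda>x. h N p x < \<mu> + V T / 2) (at_left ?\<nu>)"
      using V[of T] by (intro order_tendstoD) auto
    then have "eventually (\<lambda>x. h N p x < \<mu> + V T / 2 \<and> (N - p) / p < x \<and> x < ?\<nu>) (at_left ?\<nu>)"
      using eventually_at_left_real[OF nu(1)] by eventually_elim auto
    then obtain x where "h N p x < \<mu> + V T / 2 \<and> (N - p) / p < x \<and> x < ?\<nu>"
      using eventually_happens' trivial_limit_at_left_real by blast
    then show ?thesis using that[of x] by auto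
  qed
  have z_less: "z t < \<kappa>" if t: "T \<le> t" for t
  proof (rule ccontr)
    assume nl: "\<not> z t < \<kappa>"
    show False
    proof (intro no_growth[of t "V T / 2"] t)
      fix x assume x: "t \<le> x" "z t \<le> z x"
      then have "h N p (z x) \<le> h N p \<kappa>" using nl \<kappa> by (intro h_le) auto
      then show "V T / 2 \<le> \<mu> + V x - h N p (z x)" using V_ge[of x] x t \<kappa>(3) by simp
    qed (use V[of T] in simp)
  qed
  \<comment> \<open>The strict gap between \<open>\<kappa>\<close> and the root gives a positive
    exponential rate even when \<open>q = q_S\<close>.\<close>
  have "\<delta> * \<kappa> < \<sigma>" using \<kappa>(2) \<delta> by (smt (verit) mult_strict_left_mono)
  moreover have "(\<sigma> - \<delta> * \<kappa>) * V t \<le> V t * (\<sigma> - \<delta> * z t)" if "T \<le> t" for t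
    using z_less[OF that] V[OF that] \<delta>(1) by (simp add: mult.commute)
  \<comment> \<open>The level \<open>Z powr (p - 1) * (N - p)\<close> bounds \<open>h\<close> on
    \<open>(0, Z]\<close>, so from \<open>b\<close> on \<open>V\<close> dominates
    \<open>h\<close>.\<close>
  ultimately obtain b where b: "T \<le> b" "\<And>t. b \<le> t \<Longrightarrow> Z powr (p - 1) * (N - p) \<le> V t"
    using exponential_growth_unbounded[of T V "\<lambda>t. V t * (\<sigma> - \<delta> * z t)" "\<sigma> - \<delta> * \<kappa>"] dV V[of T]
    by auto
  show False
  proof (rule no_growth[OF b(1) \<mu>(1)])
    fix t assume t: "b \<le> t"
    have "(p - 1) * z t \<le> N - p"
      using z_le[of t] t b(1) p by (simp add: Z_def field_simps)
    then have "h N p (z t) \<le> Z powr (p - 1) * (N - p)"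
      using z_le[of t] z[of t] t b(1) p unfolding h_def
      by (intro mult_mono' powr_mono2) auto
    then show "\<mu> \<le> \<mu> + V t - h N p (z t)" using b(2)[OF t] by simp
  qed
qed

section \<open>From radial solutions to the autonomous system\<close>

context
  fixes N p s \<mu> q R0 :: real and v :: "real \<Rightarrow> real"
  assumes sol: "positive_solution N p s \<mu> q R0 v"
    and p: "1 < p" "p < N" and \<mu>: "0 < \<mu>" and R0: "0 < R0"
begin

lemma solution_pos: "R0 < r \<Longrightarrow> 0 < v r"
  using sol by (simp add: positive_solution_def)

lemma solution_deriv: "R0 < r \<Longrightarrow> (v has_real_derivative deriv v r) (at r)"
  using sol unfolding positive_solution_def
  by (auto simp: C1_differentiable_on_eq DERIV_deriv_iff_real_differentiable)

lemma flux_deriv: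
  assumes "R0 < r"
  shows "(flux N p v has_real_derivative
    - (\<mu> * r powr (N - 1 - p) * v r powr (p - 1) + r powr (N - 1 + s) * v r powr q)) (at r)"
proof -
  have "(flux N p v has_real_derivative deriv (flux N p v) r) (at r)"
    using sol assms unfolding positive_solution_def
    by (auto simp: C1_differentiable_on_eq DERIV_deriv_iff_real_differentiable)
  moreover have "deriv (flux N p v) r =
    - (\<mu> * r powr (N - 1 - p) * v r powr (p - 1) + r powr (N - 1 + s) * v r powr q)"
    using sol assms unfolding positive_solution_def by (metis minus_equation_iff)
  ultimately show ?thesis by simp
qed

lemma flux_neg_iff: "R0 < r \<Longrightarrow> flux N p v r < 0 \<longleftrightarrow> deriv v r < 0"
  using R0 by (auto simp: flux_def mult_less_0_iff zero_less_mult_iff powr_gt_zero)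

text \<open>The flux is nonincreasing and has the sign of \<open>v'\<close>, so one point with
  \<open>v' < 0\<close> is enough. Without such a point \<open>v\<close> would stay bounded below
  and the flux would be driven below zero.\<close>

lemma solution_eventually_decreasing:
  obtains R where "R0 < R" "\<And>r. R \<le> r \<Longrightarrow> deriv v r < 0"
proof -
  define R1 where "R1 = R0 + 1"
  have R1: "R0 < R1" "1 \<le> R1" using R0 by (auto simp: R1_def)
  have "\<exists>r\<ge>R1. deriv v r < 0"
  proof (rule ccontr)
    assume "\<not> ?thesis"
    then have nn: "0 \<le> deriv v r" if "R1 \<le> r" for r using that by force
    have v_ge: "v R1 \<le> v r" if "R1 \<le> r" for r
      using that nn solution_deriv R1
      by (intro DERIV_nonneg_imp_nondecreasing[OF that]) (meson order_less_le_trans)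
    define c where "c = \<mu> * v R1 powr (p - 1)"
    \<comment> \<open>In logarithmic time the chain rule turns \<open>r powr (N - 1 - p)\<close>
      into \<open>r powr (N - p)\<close>, which is at least 1 for \<open>r \<ge> 1\<close>; hence
      the choice of \<open>R1\<close>.\<close>
    define F where "F = (\<lambda>t. - flux N p v (exp t))"
    have "0 < c" using \<mu> solution_pos[OF R1(1)] by (simp add: c_def)
    let ?g = "\<lambda>r. \<mu> * r powr (N - 1 - p) * v r powr (p - 1) + r powr (N - 1 + s) * v r powr q"
    have ge: "R1 \<le> exp t" "R0 < exp t" if "ln R1 \<le> t" for t
    proof -
      show "R1 \<le> exp t" using that R1 exp_le_cancel_iff[of "ln R1" t] by simp
      then show "R0 < exp t" using R1 by simp
    qed
    obtain t where t: "ln R1 \<le> t" "0 < F t"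
    proof (rule linear_growth_unbounded[of "ln R1" F "\<lambda>t. ?g (exp t) * exp t" c 0])
      fix t assume "ln R1 \<le> t"
      note ge = ge[OF this]
      show "(F has_real_derivative ?g (exp t) * exp t) (at t)"
        unfolding F_def
        by (auto intro!: derivative_eq_intros DERIV_chain2[OF flux_deriv] ge simp: algebra_simps)
      have "c \<le> \<mu> * v (exp t) powr (p - 1)"
        unfolding c_def using \<mu> p v_ge[OF ge(1)] solution_pos[OF R1(1)]
        by (intro mult_left_mono powr_mono2) auto
      also have "\<dots> \<le> \<mu> * v (exp t) powr (p - 1) * exp t powr (N - p)"
      proof -
        have "1 \<le> exp t powr (N - p)" using ge(1) R1 p by (intro ge_one_powr_ge_zero) linarith+
        then show ?thesis
          using \<mu> mult_left_mono[of 1 "exp t powr (N - p)" "\<mu> * v (exp t) powr (p - 1)"] by simp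
      qed
      also have "\<dots> = \<mu> * exp t powr (N - 1 - p) * v (exp t) powr (p - 1) * exp t"
        using powr_add[of "exp t" "N - 1 - p" 1] by simp
      also have "\<dots> \<le> ?g (exp t) * exp t" by simp
      finally show "c \<le> ?g (exp t) * exp t" .
    qed (use \<open>0 < c\<close> in auto)
    then show False using flux_neg_iff[OF ge(2)[OF t(1)]] nn[OF ge(1)[OF t(1)]] by (simp add: F_def)
  qed
  then obtain R where R: "R1 \<le> R" "deriv v R < 0" by auto
  have "deriv v r < 0" if "R \<le> r" for r
  proof -
    have "flux N p v r \<le> flux N p v R"
    proof (rule DERIV_nonpos_imp_nonincreasing[OF that])
      fix x assume "R \<le> x" "x \<le> r"
      then have "R0 < x" using R R1 by simp
      moreover have "0 \<le> \<mu> * x powr (N - 1 - p) * v x powr (p - 1) + x powr (N - 1 + s) * v x powr q"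
        using \<mu> by simp
      ultimately show "\<exists>y. (flux N p v has_real_derivative y) (at x) \<and> y \<le> 0"
        using flux_deriv neg_le_0_iff_le by blast
    qed
    then show ?thesis using flux_neg_iff[of r] flux_neg_iff[of R] R R1 that by auto
  qed
  then show ?thesis using that[of R] R R1 by auto
qed

text \<open>Eventual decrease of \<open>v\<close> makes \<open>z\<close> positive; in logarithmic
  time the powers of \<open>r\<close> cancel, which makes the system autonomous.\<close>

lemma emden_fowler_system:
  obtains T z V where "\<And>t. T \<le> t \<Longrightarrow> 0 < z t" "\<And>t. T \<le> t \<Longrightarrow> 0 < V t"
    "\<And>t. T \<le> t \<Longrightarrow>
      ((\<lambda>t. z t powr (p - 1)) has_real_derivative \<mu> + V t - h N p (z t)) (at t)"
    "\<And>t. T \<le> t \<Longrightarrow> (V has_real_derivative V t * (p + s - (q - p + 1) * z t)) (at t)"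
proof -
  obtain R where R: "R0 < R" and dec: "\<And>r. R \<le> r \<Longrightarrow> deriv v r < 0"
    by (rule solution_eventually_decreasing) blast
  \<comment> \<open>The shift by 1 leaves an open neighbourhood of each \<open>t \<ge> T\<close> on
    which \<open>zY\<close> holds, so the derivative of \<open>Y\<close> passes to
    \<open>z powr (p - 1)\<close>.\<close>
  define T where "T = ln R + 1"
  define z where "z = (\<lambda>t. - exp t * deriv v (exp t) / v (exp t))"
  define V where "V = (\<lambda>t. exp ((p + s) * t) * v (exp t) powr (q - p + 1))"
  \<comment> \<open>Rewrites \<open>z powr (p - 1)\<close> through the flux, since the equation
    differentiates the flux and \<open>v'\<close> itself need not be differentiable.\<close>
  define Y where "Y = (\<lambda>t. - flux N p v (exp t) * exp ((p - N) * t) * v (exp t) powr (1 - p))"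
  have ge: "R < exp t" "R0 < exp t" if "ln R < t" for t
    using that R R0 by (metis exp_less_cancel_iff exp_ln less_trans)+
  have dv: "((\<lambda>t. v (exp t)) has_real_derivative - v (exp t) * z t) (at t)" if "ln R < t" for t
    using solution_pos[OF ge(2)[OF that]]
      DERIV_chain2[OF solution_deriv[OF ge(2)[OF that]] DERIV_exp]
    by (simp add: z_def mult.commute)
  have dv_powr: "((\<lambda>t. v (exp t) powr a) has_real_derivative - a * v (exp t) powr a * z t) (at t)"
    if t: "ln R < t" for a t
  proof -
    have v: "0 < v (exp t)" using solution_pos ge[OF t] by auto
    then have "v (exp t) powr (a - 1) * v (exp t) = v (exp t) powr a"
      using powr_add[of "v (exp t)" "a - 1" 1] by simp
    then show ?thesis
      using DERIV_chain2[OF has_real_derivative_powr[OF v, of a] dv[OF t]]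
      by (simp add: mult.assoc flip: mult.assoc[of "v (exp t) powr (a - 1)"])
  qed
  have z_pos: "0 < z t" if "ln R < t" for t
    using dec[of "exp t"] ge[OF that] solution_pos[OF ge(2)[OF that]]
    by (simp add: z_def divide_neg_pos mult_pos_neg)
  have zY: "z t powr (p - 1) = Y t" if "ln R < t" for t
  proof -
    let ?d = "- deriv v (exp t)" and ?v = "v (exp t)"
    have d: "0 < ?d" and v: "0 < ?v"
      using dec[of "exp t"] ge[OF that] solution_pos by auto
    have "z t powr (p - 1) = exp ((p - 1) * t) * ?d powr (p - 1) * ?v powr (1 - p)"
      using d v powr_minus_divide[of ?v "p - 1"] powr_mult[of "exp t" ?d "p - 1"]
        powr_divide[of "exp t * ?d" ?v "p - 1"]
      by (simp add: z_def powr_def[of "exp t"])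
    also have "?d powr (p - 1) = ?d powr (p - 2) * ?d"
      using d powr_add[of ?d "p - 2" 1] by simp
    also have "exp ((p - 1) * t) = exp t powr (N - 1) * exp ((p - N) * t)"
      by (simp add: powr_def flip: exp_add) (simp add: algebra_simps)
    finally show ?thesis using d by (simp add: Y_def flux_def)
  qed
  have dY: "(Y has_real_derivative \<mu> + V t - h N p (z t)) (at t)" if t: "ln R < t" for t
  proof -
    let ?v = "v (exp t)"
    let ?g = "\<mu> * exp t powr (N - 1 - p) * ?v powr (p - 1) + exp t powr (N - 1 + s) * ?v powr q"
    have v: "0 < ?v" using solution_pos ge[OF t] by auto
    \<comment> \<open>The three summands come from the flux, the exponential weight and the power of
      \<open>v\<close>; the last two add up to \<open>- h N p (z t)\<close>.\<close>
    have "(Y has_real_derivative ?g * exp t * exp ((p - N) * t) * ?v powr (1 - p)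
        + Y t * (p - N) + Y t * (p - 1) * z t) (at t)"
    proof -
      have "((\<lambda>t. v (exp t) powr (1 - p)) has_real_derivative (p - 1) * ?v powr (1 - p) * z t) (at t)"
        using dv_powr[OF t, of "1 - p"] by simp
      moreover have "((\<lambda>t. flux N p v (exp t)) has_real_derivative - ?g * exp t) (at t)"
        using DERIV_chain2[OF flux_deriv[OF ge(2)[OF t]] DERIV_exp] by simp
      moreover have "((\<lambda>t. exp ((p - N) * t)) has_real_derivative (p - N) * exp ((p - N) * t)) (at t)"
        by (auto intro!: derivative_eq_intros)
      ultimately show ?thesis unfolding Y_def
        by - (rule DERIV_cong, (rule DERIV_mult DERIV_minus | assumption)+, simp add: algebra_simps)
    qed
    moreover have "?g * exp t * exp ((p - N) * t) * ?v powr (1 - p) = \<mu> + V t"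
    proof -
      \<comment> \<open>The exponents of \<open>exp t\<close> add up to \<open>0\<close> and
        \<open>p + s\<close>.\<close>
      have "exp t powr (N - 1 - p) * exp t * exp ((p - N) * t) = 1"
        "exp t powr (N - 1 + s) * exp t * exp ((p - N) * t) = exp ((p + s) * t)"
        by (simp_all add: powr_def flip: exp_add) (simp_all add: algebra_simps)
      moreover have "?v powr (p - 1) * ?v powr (1 - p) = 1"
        "?v powr q * ?v powr (1 - p) = ?v powr (q - p + 1)"
        using v by (simp_all flip: powr_add) (simp_all add: algebra_simps)
      moreover have "?g * exp t * exp ((p - N) * t) * ?v powr (1 - p) =
        \<mu> * (exp t powr (N - 1 - p) * exp t * exp ((p - N) * t)) * (?v powr (p - 1) * ?v powr (1 - p))
        + (exp t powr (N - 1 + s) * exp t * exp ((p - N) * t)) * (?v powr q * ?v powr (1 - p))"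
        by (simp only: algebra_simps)
      ultimately show ?thesis by (simp add: V_def)
    qed
    moreover have "h N p (z t) = - Y t * (p - N) - Y t * (p - 1) * z t"
      using zY[OF t] by (simp add: h_def algebra_simps)
    ultimately show ?thesis by - (rule DERIV_cong, assumption, linarith)
  qed
  show ?thesis
  proof (rule that[of T z V])
    fix t assume "T \<le> t"
    then have t: "ln R < t" by (simp add: T_def)
    have v: "0 < v (exp t)" using solution_pos ge[OF t] by auto
    show "0 < z t" "0 < V t" using z_pos[OF t] v by (auto simp: V_def)
    show "((\<lambda>t. z t powr (p - 1)) has_real_derivative \<mu> + V t - h N p (z t)) (at t)"
      by (rule has_field_derivative_transform_within_open[OF dY[OF t], of "{ln R<..}"])
        (use t zY in auto)
    show "(V has_real_derivative V t * (p + s - (q - p + 1) * z t)) (at t)"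
      unfolding V_def
      by (rule DERIV_cong[OF DERIV_mult[OF DERIV_chain2[OF DERIV_exp DERIV_cmult_Id] dv_powr[OF t]]])
        (simp add: algebra_simps)
  qed
qed

end

theorem theorem1p7:
  fixes N p s \<mu> q :: real
  assumes "1 < p" and "p < N"
    and "- p < s"
    and "0 < \<mu>" and "\<mu> < mu_bar N p"
    and "p - 1 < q" and "q \<le> q_S N p s \<mu>"
  shows "\<forall>R0>0. \<not> (\<exists>v. positive_solution N p s \<mu> q R0 v)"
proof (intro allI impI notI)
  fix R0 :: real assume "0 < R0" "\<exists>v. positive_solution N p s \<mu> q R0 v"
  then obtain v where sol: "positive_solution N p s \<mu> q R0 v" by blast
  have "0 < (N - p) / p" using assms by simp
  then have nu: "0 < nu_plus N p \<mu>"
    using nu_plus_properties(1)[of p N \<mu>] assms by linarith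
  \<comment> \<open>Clearing the positive denominator in \<open>q_S\<close> gives the form required
    by \<open>no_global_orbit\<close>.\<close>
  have "0 < q - p + 1" "(q - p + 1) * nu_plus N p \<mu> \<le> p + s"
    using assms(6,7) nu by (simp_all add: q_S_def field_simps)
  then show False
    using emden_fowler_system[OF sol assms(1,2,4) \<open>0 < R0\<close>]
      no_global_orbit[OF assms(1,2,4,5)] by metis
qed

end
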